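(* Let $Y$ be a vector lattice and let $X\subseteq Y$ be a sublattice. If $T\colon X\to Y$ is a map satisfying $$|T(x)-T(y)|=|x-y|\qquad\text{for all } x,y\in X,$$ then $T-T(0)$ is a disjointness preserving linear map. Furthermore, if $X$ is an ideal of $Y$, then $\operatorname{Range}(T-T(0))=X$ and $(T-T(0))^2=\operatorname{Id}_X$ (where the square denotes composition).
   Context: All vector spaces are real and nontrivial. Maps are not assumed linear or affine unless stated; "linear" means $\mathbb{R}$-linear. A *vector lattice* is a vector space with a partial order compatible with the linear structure ($x\le y$ implies $x+z\le y+z$ and $ax\le ay$ for real $a\ge 0$) in which every pair $x,y$ has a supremum $x\vee y$ and an infimum $x\wedge y$. The modulus is $|x|:=x\vee(-x)$, and $x^+:=x\vee 0$, $x^-:=(-x)\vee 0$. The five lattice operations are $|x|$, $x\wedge y$, $x\vee y$, $x^+$, $x^-$. Vectors $x,y$ are *disjoint*, written $x\perp y$, if $|x|\wedge|y|=0$. A *sublattice* of a vector lattice is a vector subspace closed under the lattice operations. A sublattice $X$ of $Y$ is an *ideal* if $x\in Y$, $z\in X$ and $|x|\le|z|$ imply $x\in X$. A map $U$ between vector lattices is *disjointness preserving* if $x\perp y$ implies $U(x)\perp U(y)$. The map $T-T(0)$ is $x\mapsto T(x)-T(0)$. *)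

theory Defs
  imports Complex_Main "HOL-Library.Lattice_Algebras"
begin

(* The class lattice_ab_group_add_abs contributes binary suprema and infima and the
   axiom \<bar>x\<bar> = sup x (- x).  No Archimedean property is assumed. *)
class vector_lattice = ordered_real_vector + lattice_ab_group_add_abs

instance real :: vector_lattice ..

definition vl_disjoint :: "'a::vector_lattice \<Rightarrow> 'a \<Rightarrow> bool" where
  "vl_disjoint x y \<longleftrightarrow> inf \<bar>x\<bar> \<bar>y\<bar> = 0"

(* The negative part is written out as sup (- x) 0, because the library's nprt x is
   inf x 0, which is its negation. *)
definition vl_sublattice :: "'a::vector_lattice set \<Rightarrow> bool" where
  "vl_sublattice X \<longleftrightarrow>
     subspace X \<and>
     (\<forall>x\<in>X. \<bar>x\<bar> \<in> X \<and> sup x 0 \<in> X \<and> sup (- x) 0 \<in> X) \<and>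
     (\<forall>x\<in>X. \<forall>y\<in>X. inf x y \<in> X \<and> sup x y \<in> X)"

definition vl_ideal :: "'a::vector_lattice set \<Rightarrow> bool" where
  "vl_ideal X \<longleftrightarrow>
     vl_sublattice X \<and> (\<forall>x. \<forall>z\<in>X. \<bar>x\<bar> \<le> \<bar>z\<bar> \<longrightarrow> x \<in> X)"

(* A map X \<rightarrow> Y is represented by a total function whose values off X are irrelevant. *)
definition linear_map_on :: "'a::real_vector set \<Rightarrow> ('a \<Rightarrow> 'b::real_vector) \<Rightarrow> bool" where
  "linear_map_on X f \<longleftrightarrow>
     (\<forall>x\<in>X. \<forall>y\<in>X. f (x + y) = f x + f y) \<and>
     (\<forall>c. \<forall>x\<in>X. f (c *\<^sub>R x) = c *\<^sub>R f x)"

(* Disjointness in a sublattice X agrees with disjointness in the ambient lattice, as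
   modulus and infimum are the same. *)
definition disjointness_preserving_on ::
  "'a::vector_lattice set \<Rightarrow> ('a \<Rightarrow> 'b::vector_lattice) \<Rightarrow> bool" where
  "disjointness_preserving_on X f \<longleftrightarrow>
     (\<forall>x\<in>X. \<forall>y\<in>X. vl_disjoint x y \<longrightarrow> vl_disjoint (f x) (f y))"

end

theory Submission
  imports Defs
begin

text \<open>
  With \<open>S = T - T 0\<close>, in a totally ordered vector space \<open>\<bar>p\<bar> = \<bar>q\<bar>\<close> means \<open>p = q\<close> or \<open>p = - q\<close>, and
  \<open>S\<close> is plus or minus the identity.  The lattice version of this dichotomy is that \<open>\<bar>p\<bar> = \<bar>q\<bar>\<close>
  implies \<open>p - q \<bottom> p + q\<close>.  To prove one of the equations \<open>u = v\<close> of the theorem, several pairs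
  \<open>p, q\<close> with the same difference \<open>w = u - v\<close> are used.  Each gives a vector disjoint from \<open>w\<close>, and as the
  disjoint complement of \<open>w\<close> is a subspace, it contains \<open>w\<close> itself, so \<open>w = 0\<close>.  For additivity
  one also needs \<open>\<bar>S x + S y\<bar> = \<bar>x + y\<bar>\<close>, which holds because \<open>\<bar>a + b\<bar> + \<bar>a - b\<bar>\<close> depends only on
  \<open>\<bar>a\<bar>\<close> and \<open>\<bar>b\<bar>\<close>.
\<close>

context lattice_ab_group_add_abs
begin

text \<open>Both sides are the supremum of the four vectors \<open>a + b\<close>,
  \<open>a - b\<close>, \<open>- a + b\<close>, \<open>- a - b\<close>.\<close>

lemma sup_abs_add_abs_diff: "sup \<bar>a + b\<bar> \<bar>a - b\<bar> = \<bar>a\<bar> + \<bar>b\<bar>"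
proof -
  have "\<bar>a\<bar> + \<bar>b\<bar> = sup (sup (a + b) (a - b)) (sup (- a + b) (- a - b))"
    by (simp add: abs_lattice add_sup_distrib_right add_sup_distrib_left ac_simps)
  also have "\<dots> = sup (sup (a + b) (- a - b)) (sup (a - b) (- a + b))"
    by (simp only: sup.assoc sup.commute sup.left_commute)
  also have "\<dots> = sup \<bar>a + b\<bar> \<bar>a - b\<bar>"
    by (simp add: abs_lattice)
  finally show ?thesis ..
qed

lemma abs_double: "\<bar>a + a\<bar> = \<bar>a\<bar> + \<bar>a\<bar>"
  using sup_abs_add_abs_diff[of a a] by (simp add: sup_absorb1)

lemma abs_add_plus_abs_diff:
  "\<bar>a + b\<bar> + \<bar>a - b\<bar> = sup (\<bar>a\<bar> + \<bar>a\<bar>) (\<bar>b\<bar> + \<bar>b\<bar>)"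
proof -
  have "(a + b) + (a - b) = a + a" "(a + b) - (a - b) = b + b"
    by (simp_all add: algebra_simps)
  then show ?thesis
    using sup_abs_add_abs_diff[of "a + b" "a - b"] by (simp add: abs_double)
qed

lemma abs_add_eq_if_abs_diff_eq:
  assumes "\<bar>a\<bar> = \<bar>x\<bar>" "\<bar>b\<bar> = \<bar>y\<bar>" "\<bar>a - b\<bar> = \<bar>x - y\<bar>"
  shows "\<bar>a + b\<bar> = \<bar>x + y\<bar>"
  using abs_add_plus_abs_diff[of a b] abs_add_plus_abs_diff[of x y] assms
  by (metis add_right_cancel)

text \<open>The right side expands to the infimum of \<open>p + p\<close>, \<open>p + r\<close>,
  \<open>q + p\<close>, \<open>q + r\<close>, each of which dominates the left side. This makes
  disjoint complements closed under addition.\<close>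

lemma inf_add_le:
  assumes "0 \<le> p" "0 \<le> q" "0 \<le> r"
  shows "inf p (q + r) \<le> inf p q + inf p r"
proof -
  have "inf p (q + r) \<le> p + p" "inf p (q + r) \<le> p + r" "inf p (q + r) \<le> q + p"
    using assms by (meson add_increasing add_increasing2 inf.coboundedI1 order_refl)+
  then show ?thesis
    by (simp add: add_inf_distrib_left add_inf_distrib_right)
qed

end

lemma vl_disjoint_abs_eq:
  assumes "\<bar>y\<bar> = \<bar>z\<bar>" "vl_disjoint x y"
  shows "vl_disjoint x z"
  using assms by (simp add: vl_disjoint_def)

lemma vl_disjoint_add:
  assumes "vl_disjoint x y" "vl_disjoint x z"
  shows "vl_disjoint x (y + z)"
proof -
  have "inf \<bar>x\<bar> \<bar>y + z\<bar> \<le> inf \<bar>x\<bar> (\<bar>y\<bar> + \<bar>z\<bar>)"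
    by (rule inf_mono) (simp_all add: abs_triangle_ineq)
  also have "\<dots> \<le> inf \<bar>x\<bar> \<bar>y\<bar> + inf \<bar>x\<bar> \<bar>z\<bar>"
    by (rule inf_add_le) simp_all
  also have "\<dots> = 0"
    using assms by (simp add: vl_disjoint_def)
  finally show ?thesis
    by (simp add: vl_disjoint_def order_antisym)
qed

lemma vl_disjoint_minus_iff: "vl_disjoint x (- y) \<longleftrightarrow> vl_disjoint x y"
  by (simp add: vl_disjoint_def)

lemma vl_disjoint_diff:
  assumes "vl_disjoint x y" "vl_disjoint x z"
  shows "vl_disjoint x (y - z)"
  using vl_disjoint_add[of x y "- z"] assms by (simp add: vl_disjoint_minus_iff)

lemma abs_scaleR_vector_lattice: "\<bar>c *\<^sub>R x\<bar> = \<bar>c\<bar> *\<^sub>R \<bar>x :: 'a::vector_lattice\<bar>"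
proof -
  have nonneg: "\<bar>c *\<^sub>R x\<bar> = c *\<^sub>R \<bar>x\<bar>" if "0 < c" for c :: real
  proof (rule order_antisym)
    have le: "\<bar>d *\<^sub>R y\<bar> \<le> d *\<^sub>R \<bar>y\<bar>" if "0 < d" for d :: real and y :: 'a
      using scaleR_left_mono[of y "\<bar>y\<bar>" d] scaleR_left_mono[of "- y" "\<bar>y\<bar>" d] that
      by (intro abs_leI) (simp_all add: abs_ge_self abs_ge_minus_self)
    show "\<bar>c *\<^sub>R x\<bar> \<le> c *\<^sub>R \<bar>x\<bar>"
      using that by (rule le)
    \<comment> \<open>The reverse inequality is \<open>le\<close> with factor \<open>1 / c\<close>
      at the vector \<open>c *\<^sub>R x\<close>.\<close>
    have "c *\<^sub>R \<bar>(1 / c) *\<^sub>R (c *\<^sub>R x)\<bar> \<le> c *\<^sub>R ((1 / c) *\<^sub>R \<bar>c *\<^sub>R x\<bar>)"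
      using that by (intro scaleR_left_mono le) simp_all
    then show "c *\<^sub>R \<bar>x\<bar> \<le> \<bar>c *\<^sub>R x\<bar>"
      using that by simp
  qed
  consider "c > 0" | "c = 0" | "- c > 0" by linarith
  then show ?thesis
  proof cases
    case 3
    then show ?thesis using nonneg[of "- c"] by simp
  qed (simp_all add: nonneg)
qed

text \<open>Natural multiples follow from additivity. A real factor is dominated in modulus by a
  natural one, so only the reals have to be Archimedean.\<close>

lemma vl_disjoint_scaleR:
  fixes x y :: "'a::vector_lattice"
  assumes "vl_disjoint x y"
  shows "vl_disjoint x (c *\<^sub>R y)"
proof -
  have nat: "vl_disjoint x (real n *\<^sub>R y)" for n
  proof (induction n)
    case 0
    then show ?case by (simp add: vl_disjoint_def inf_absorb2)
  next
    case (Suc n)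
    from vl_disjoint_add[OF assms this] show ?case
      by (simp add: scaleR_add_left)
  qed
  obtain n :: nat where n: "\<bar>c\<bar> \<le> real n"
    using real_arch_simple by blast
  have "inf \<bar>x\<bar> \<bar>c *\<^sub>R y\<bar> \<le> inf \<bar>x\<bar> \<bar>real n *\<^sub>R y\<bar>"
    using n by (intro inf_mono scaleR_right_mono) (simp_all add: abs_scaleR_vector_lattice scaleR_right_mono)
  with nat[of n] show ?thesis
    by (simp add: vl_disjoint_def order_antisym)
qed

lemma vl_disjoint_double:
  fixes x y :: "'a::vector_lattice"
  assumes "vl_disjoint x (y + y)"
  shows "vl_disjoint x y"
  using vl_disjoint_scaleR[OF assms, of "1 / 2"] by (simp flip: scaleR_2)

lemma vl_disjoint_self: "vl_disjoint x x \<Longrightarrow> x = 0"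
  by (simp add: vl_disjoint_def)

text \<open>For equal moduli, the supremum and the sum of \<open>\<bar>a + b\<bar>\<close> and
  \<open>\<bar>a - b\<bar>\<close> are both \<open>\<bar>a\<bar> + \<bar>a\<bar>\<close>, so their
  infimum vanishes.\<close>

lemma vl_disjoint_diff_add:
  assumes "\<bar>a\<bar> = \<bar>b\<bar>"
  shows "vl_disjoint (a - b) (a + b)"
proof -
  have "inf \<bar>a + b\<bar> \<bar>a - b\<bar> + sup \<bar>a + b\<bar> \<bar>a - b\<bar> = \<bar>a + b\<bar> + \<bar>a - b\<bar>"
    using add_eq_inf_sup[of "\<bar>a + b\<bar>" "\<bar>a - b\<bar>"] by (simp add: add.commute)
  then have "inf \<bar>a + b\<bar> \<bar>a - b\<bar> = 0"
    using assms by (simp add: sup_abs_add_abs_diff abs_add_plus_abs_diff)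
  then show ?thesis
    by (simp add: vl_disjoint_def inf.commute)
qed

text \<open>The pairs are \<open>u, a + b\<close>, then \<open>u - a, b\<close>, then
  \<open>u - b, a\<close>. The sums of the last two pairs add up to \<open>u + u\<close>.\<close>

lemma eq_add_if_abs_eq:
  fixes u a b :: "'a::vector_lattice"
  assumes "\<bar>u\<bar> = \<bar>a + b\<bar>" "\<bar>u - a\<bar> = \<bar>b\<bar>" "\<bar>u - b\<bar> = \<bar>a\<bar>"
  shows "u = a + b"
proof -
  let ?w = "u - (a + b)"
  have sum: "vl_disjoint ?w (u + (a + b))"
    using vl_disjoint_diff_add[OF assms(1)] .
  have "vl_disjoint ?w (u - a + b)" "vl_disjoint ?w (u - b + a)"
    using vl_disjoint_diff_add[OF assms(2)] vl_disjoint_diff_add[OF assms(3)]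
    by (simp_all add: algebra_simps)
  from vl_disjoint_add[OF this] have "vl_disjoint ?w (u + u)"
    by (simp add: algebra_simps)
  then have u: "vl_disjoint ?w u"
    by (rule vl_disjoint_double)
  from vl_disjoint_diff[OF sum u] have "vl_disjoint ?w (a + b)"
    by simp
  from vl_disjoint_diff[OF u this] show ?thesis
    using vl_disjoint_self by fastforce
qed

text \<open>The pairs \<open>u, c *\<^sub>R a\<close> and \<open>u - a, (c - 1) *\<^sub>R a\<close>
  have sums that differ by \<open>a + a\<close>.\<close>

lemma eq_scaleR_if_abs_eq:
  fixes u a :: "'a::vector_lattice"
  assumes "\<bar>u\<bar> = \<bar>c *\<^sub>R a\<bar>" "\<bar>u - a\<bar> = \<bar>(c - 1) *\<^sub>R a\<bar>"
  shows "u = c *\<^sub>R a"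
proof -
  let ?w = "u - c *\<^sub>R a"
  have sum: "vl_disjoint ?w (u + c *\<^sub>R a)"
    using vl_disjoint_diff_add[OF assms(1)] .
  have "vl_disjoint ?w (u - a + (c - 1) *\<^sub>R a)"
    using vl_disjoint_diff_add[OF assms(2)] by (simp add: algebra_simps)
  from vl_disjoint_diff[OF sum this] have "vl_disjoint ?w (a + a)"
    by (simp add: algebra_simps)
  then have "vl_disjoint ?w a"
    by (rule vl_disjoint_double)
  then have ca: "vl_disjoint ?w (c *\<^sub>R a)"
    by (rule vl_disjoint_scaleR)
  with assms(1) have "vl_disjoint ?w u"
    by (metis vl_disjoint_abs_eq)
  from vl_disjoint_diff[OF this ca] show ?thesis
    using vl_disjoint_self by fastforce
qed

text \<open>Used for the involution, with \<open>u = S (S x)\<close> and \<open>a = S x\<close>. The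
  sums of the pairs \<open>u, x\<close> and \<open>u - a, x - a\<close> differ by
  \<open>a + a\<close>, and disjointness from \<open>a\<close> passes to \<open>u\<close> and
  \<open>x\<close> by equality of moduli.\<close>

lemma eq_if_abs_eq:
  fixes u a x :: "'a::vector_lattice"
  assumes "\<bar>u\<bar> = \<bar>x\<bar>" "\<bar>a\<bar> = \<bar>x\<bar>" "\<bar>u - a\<bar> = \<bar>x - a\<bar>"
  shows "u = x"
proof -
  let ?w = "u - x"
  have "vl_disjoint ?w (u - a + (x - a))"
    using vl_disjoint_diff_add[OF assms(3)] by simp
  from vl_disjoint_diff[OF vl_disjoint_diff_add[OF assms(1)] this]
  have "vl_disjoint ?w (a + a)"
    by (simp add: algebra_simps)
  then have a: "vl_disjoint ?w a"
    by (rule vl_disjoint_double)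
  have "vl_disjoint ?w u" "vl_disjoint ?w x"
    using assms by (auto intro: vl_disjoint_abs_eq[OF _ a])
  from vl_disjoint_diff[OF this] show ?thesis
    using vl_disjoint_self by fastforce
qed

theorem theorem1p3:
  fixes X :: "'a::vector_lattice set" and T :: "'a \<Rightarrow> 'a"
  assumes "vl_sublattice X"
    and "X \<noteq> {0}"
    and "\<forall>x\<in>X. \<forall>y\<in>X. \<bar>T x - T y\<bar> = \<bar>x - y\<bar>"
  shows "linear_map_on X (\<lambda>x. T x - T 0) \<and>
    disjointness_preserving_on X (\<lambda>x. T x - T 0) \<and>
    (vl_ideal X \<longrightarrow>
       (\<lambda>x. T x - T 0) ` X = X \<and>
       (\<forall>x\<in>X. ((\<lambda>x. T x - T 0) ^^ 2) x = x))"
proof -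
  define S where "S = (\<lambda>x. T x - T 0)"
  have sub: "subspace X"
    using assms(1) by (simp add: vl_sublattice_def)
  note mem = subspace_0[OF sub] subspace_add[OF sub] subspace_scale[OF sub]
  have iso: "\<bar>S x - S y\<bar> = \<bar>x - y\<bar>" if "x \<in> X" "y \<in> X" for x y
    using assms(3) that by (simp add: S_def)
  have abs_S: "\<bar>S x\<bar> = \<bar>x\<bar>" if "x \<in> X" for x
    using assms(3) that mem(1) by (force simp: S_def)
  have "S (x + y) = S x + S y" if "x \<in> X" "y \<in> X" for x y
  proof (rule eq_add_if_abs_eq)
    show "\<bar>S (x + y)\<bar> = \<bar>S x + S y\<bar>"
      using abs_add_eq_if_abs_diff_eq[of "S x" x "S y" y] that
      by (simp add: abs_S iso mem)
  qed (use that in \<open>simp_all add: abs_S iso mem\<close>)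
  moreover have "S (c *\<^sub>R x) = c *\<^sub>R S x" if "x \<in> X" for c x
  proof (rule eq_scaleR_if_abs_eq)
    have "\<bar>S (c *\<^sub>R x) - S x\<bar> = \<bar>(c - 1) *\<^sub>R x\<bar>"
      using that by (simp add: iso mem scaleR_diff_left)
    then show "\<bar>S (c *\<^sub>R x) - S x\<bar> = \<bar>(c - 1) *\<^sub>R S x\<bar>"
      using that by (simp add: abs_S abs_scaleR_vector_lattice)
  qed (use that in \<open>simp add: abs_S mem abs_scaleR_vector_lattice\<close>)
  ultimately have "linear_map_on X S"
    by (simp add: linear_map_on_def)
  moreover have "disjointness_preserving_on X S"
    by (simp add: disjointness_preserving_on_def vl_disjoint_def abs_S)
  moreover have "S ` X = X \<and> (\<forall>x\<in>X. (S ^^ 2) x = x)" if ideal: "vl_ideal X"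
  proof -
    \<comment> \<open>The ideal property keeps \<open>S x\<close> in \<open>X\<close>, so
      \<open>iso\<close> applies to the points \<open>S x\<close> and \<open>x\<close>.\<close>
    have S_mem: "S x \<in> X" if "x \<in> X" for x
      using ideal abs_S[OF that] that unfolding vl_ideal_def by (metis order_refl)
    have SS: "S (S x) = x" if "x \<in> X" for x
    proof (rule eq_if_abs_eq)
      show "\<bar>S (S x) - S x\<bar> = \<bar>x - S x\<bar>"
        using that by (simp add: iso S_mem abs_minus_commute)
    qed (use that in \<open>simp_all add: abs_S S_mem\<close>)
    then have "S ` X = X"
      using S_mem by (metis image_subsetI image_eqI subsetI subset_antisym)
    then show ?thesis
      using SS by (simp add: numeral_2_eq_2)
  qed
  ultimately show ?thesis
    by (simp add: S_def)
qed

end
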